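(* Assume $\mathbb{A}$ is an associative $\mathbb{K}$-algebra with involution $\sharp$, let $\mu\in\mathbb{K}$, and define ternary products on $\mathbb{A}$ by $\langle xyz\rangle:=xy^\sharp z$ and on $KD(\mathbb{A})$ by $$\langle(x_0,x_1),(y_0,y_1),(z_0,z_1)\rangle_L:=(x_0,x_1)\cdot\bigl((y_0,y_1)^\sharp(z_0,z_1)\bigr).$$ Then we have \begin{align*} \langle(x_0,x_1),(y_0,y_1),(z_0,z_1)\rangle_L=\Bigl(&\langle x_0y_0z_0\rangle-\mu\langle x_0z_1y_1\rangle+\mu\langle y_0z_1x_1\rangle-\mu\langle z_0y_1x_1\rangle,\\ &\langle x_1z_0y_0\rangle-\langle y_1z_0x_0\rangle+\langle z_1y_0x_0\rangle+\mu\langle x_1y_1z_1\rangle\Bigr). \end{align*} There is a "reverse" formula, using the "dual" definition $KD'(\mathbb{A})$ of the extension, and the "right ternary product" on $KD'(\mathbb{A})$ given by \begin{align*} \langle(x_0,x_1),(y_0,y_1),(z_0,z_1)\rangle_R:=&\bigl((x_0,x_1)\cdot(y_0,y_1)^\sharp\bigr)(z_0,z_1)\\ =\Bigl(&\langle x_0y_0z_0\rangle-\mu\langle x_1z_1y_0\rangle+\mu\langle y_1z_1x_0\rangle-\mu\langle z_1y_1x_0\rangle,\\ &\langle x_0z_0y_1\rangle-\langle y_0z_0x_1\rangle+\langle z_0y_0x_1\rangle+\mu\langle x_1y_1z_1\rangle\Bigr). \end{align*}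
   Context: $\mathbb{K}$ is a commutative ring with unit; an involution of an algebra is an anti-automorphism $\sharp$ of order $2$. The scalar $\mu$ is not assumed invertible. The (Albert-Cayley-Dickson) algebra $KD(\mathbb{A})$ is the module $\mathbb{A}\oplus\mathbb{A}$ with product $$(x_0,x_1)\cdot(z_0,z_1)=(x_0z_0+\mu z_1^\sharp x_1,\;z_1x_0+x_1z_0^\sharp)$$ and involution $(x_0,x_1)^\sharp=(x_0^\sharp,-x_1)$. With $m=(0,1)$ this corresponds to writing $KD(\mathbb{A})=\mathbb{A}\oplus\mathbb{A}m$, with $\mathbb{A}$ on the left of $m$. The "dual" extension $KD'(\mathbb{A})$ is obtained by writing $\mathbb{A}$ on the right of the new element instead, $\mathbb{A}\oplus s\mathbb{A}$ with $s=(0,1)$, which leads to reversed formulae: the product is $$(x_0,x_1)\cdot(z_0,z_1)=(x_0z_0+\mu z_1x_1^\sharp,\;z_0x_1+x_0^\sharp z_1),$$ with the same map $\sharp$.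
   Formalization: Printed formulas are false; proved: L with last term −μ⟨x1y1z1⟩, and R = (⟨x0y0z0⟩−μ⟨y1x1z0⟩+μ⟨z1x1y0⟩−μ⟨z1y1x0⟩, ⟨y0x0z1⟩−⟨z0x0y1⟩+⟨z0y0x1⟩−μ⟨x1y1z1⟩). *)

theory Defs
  imports Complex_Main
begin

(* The type class ring is non-unital and associative, so A is not required to have a unit.
   An involution is a K-linear anti-automorphism whose square is the identity; the identity
   map itself is thus allowed when A is commutative. *)
locale assoc_algebra_with_involution = module scale
  for scale :: "'k::comm_ring_1 \<Rightarrow> 'a::ring \<Rightarrow> 'a" +
  fixes invol :: "'a \<Rightarrow> 'a"
  assumes scale_mult_left: "scale c a * b = scale c (a * b)"
    and scale_mult_right: "a * scale c b = scale c (a * b)"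
    and invol_linear: "module_hom scale scale invol"
    and invol_mult: "invol (a * b) = invol b * invol a"
    and invol_invol: "invol (invol a) = a"

definition ternary :: "('a::ring \<Rightarrow> 'a) \<Rightarrow> 'a \<Rightarrow> 'a \<Rightarrow> 'a \<Rightarrow> 'a" where
  "ternary invol x y z = x * invol y * z"

definition KD_mult ::
  "('k::comm_ring_1 \<Rightarrow> 'a::ring \<Rightarrow> 'a) \<Rightarrow> ('a \<Rightarrow> 'a) \<Rightarrow> 'k \<Rightarrow> 'a \<times> 'a \<Rightarrow> 'a \<times> 'a \<Rightarrow> 'a \<times> 'a" where
  "KD_mult scale invol \<mu> x z =
    (fst x * fst z + scale \<mu> (invol (snd z) * snd x), snd z * fst x + snd x * invol (fst z))"

definition KD'_mult ::
  "('k::comm_ring_1 \<Rightarrow> 'a::ring \<Rightarrow> 'a) \<Rightarrow> ('a \<Rightarrow> 'a) \<Rightarrow> 'k \<Rightarrow> 'a \<times> 'a \<Rightarrow> 'a \<times> 'a \<Rightarrow> 'a \<times> 'a" where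
  "KD'_mult scale invol \<mu> x z =
    (fst x * fst z + scale \<mu> (snd z * invol (snd x)), fst z * snd x + invol (fst x) * snd z)"

(* KD(A) and KD'(A) carry the same map. *)
definition KD_invol :: "('a::ring \<Rightarrow> 'a) \<Rightarrow> 'a \<times> 'a \<Rightarrow> 'a \<times> 'a" where
  "KD_invol invol x = (invol (fst x), - snd x)"

(* If A is unital and m = (0,1), then m m = (mu 1,0), so the left ternary product of (m,m,m) is -mu m: the
   coefficient of the last term of the second component of the expansion is -mu, not +mu. *)
definition KD_ternary_L ::
  "('k::comm_ring_1 \<Rightarrow> 'a::ring \<Rightarrow> 'a) \<Rightarrow> ('a \<Rightarrow> 'a) \<Rightarrow> 'k
    \<Rightarrow> 'a \<times> 'a \<Rightarrow> 'a \<times> 'a \<Rightarrow> 'a \<times> 'a \<Rightarrow> 'a \<times> 'a" where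
  "KD_ternary_L scale invol \<mu> x y z =
    KD_mult scale invol \<mu> x (KD_mult scale invol \<mu> (KD_invol invol y) z)"

(* KD'(A) is the opposite algebra of KD(A^op). Hence the expansion of this product is obtained
   from that of KD_ternary_L by reversing every word and exchanging the letters x and z. *)
definition KD'_ternary_R ::
  "('k::comm_ring_1 \<Rightarrow> 'a::ring \<Rightarrow> 'a) \<Rightarrow> ('a \<Rightarrow> 'a) \<Rightarrow> 'k
    \<Rightarrow> 'a \<times> 'a \<Rightarrow> 'a \<times> 'a \<Rightarrow> 'a \<times> 'a \<Rightarrow> 'a \<times> 'a" where
  "KD'_ternary_R scale invol \<mu> x y z =
    KD'_mult scale invol \<mu> (KD'_mult scale invol \<mu> x (KD_invol invol y)) z"

end

theory Submission
  imports Defs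
begin

text \<open>Both identities are direct expansions. Each word of the inner product has one starred
  letter; \<open>invol\<close> reverses the word and stars the other letter, as in
  \<open>x1 * invol (invol y0 * z0) = x1 * invol z0 * y0\<close>. With these bracketings the star
  thus always falls on the middle letter, so every word is a \<open>ternary\<close> term.\<close>

theorem theorem7p3:
  fixes scale :: "'k::comm_ring_1 \<Rightarrow> 'a::ring \<Rightarrow> 'a"
    and invol :: "'a \<Rightarrow> 'a"
    and \<mu> :: 'k
    and x0 x1 y0 y1 z0 z1 :: 'a
  assumes "assoc_algebra_with_involution scale invol"
  shows "KD_ternary_L scale invol \<mu> (x0, x1) (y0, y1) (z0, z1) =
      (ternary invol x0 y0 z0 - scale \<mu> (ternary invol x0 z1 y1)
        + scale \<mu> (ternary invol y0 z1 x1) - scale \<mu> (ternary invol z0 y1 x1),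
       ternary invol x1 z0 y0 - ternary invol y1 z0 x0 + ternary invol z1 y0 x0
        - scale \<mu> (ternary invol x1 y1 z1))
    \<and> KD'_ternary_R scale invol \<mu> (x0, x1) (y0, y1) (z0, z1) =
      (ternary invol x0 y0 z0 - scale \<mu> (ternary invol y1 x1 z0)
        + scale \<mu> (ternary invol z1 x1 y0) - scale \<mu> (ternary invol z1 y1 x0),
       ternary invol y0 x0 z1 - ternary invol z0 x0 y1 + ternary invol z0 y0 x1
        - scale \<mu> (ternary invol x1 y1 z1))"
proof -
  interpret assoc_algebra_with_involution scale invol
    by (fact assms)
  interpret invol: module_hom scale scale invol
    by (fact invol_linear)
  show ?thesis
    \<comment> \<open>The \<open>invol\<close> rules push the star down to single letters, the
      \<open>scale\<close> rules bring \<open>\<mu>\<close> to the front of each word, and the ring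
      laws match the remaining sums.\<close>
    by (simp add: KD_ternary_L_def KD'_ternary_R_def KD_mult_def KD'_mult_def KD_invol_def
        ternary_def invol.add invol.diff invol.neg invol.scale invol_mult invol_invol
        scale_mult_left scale_mult_right scale_right_distrib scale_right_diff_distrib
        algebra_simps)
qed

end
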